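(* For each $m\in\mathbb{N}$ let $P_m$ be a monic polynomial of degree $m$ with only real roots. Assume that $m_1(P_m)\to a\in\mathbb{R}$ and $m_2(P_m)=o(m)$ as $m\to\infty$. Then for any $d\in\mathbb{N}$, $$\lim_{n\to\infty}\frac{1}{(n+d)_n}\left(\frac{d}{dz}\right)^{n}P_{d+n}(z)=(z-a)^d$$ uniformly on compact subsets of the complex plane.
   Context: For a polynomial $P$ of degree $m$ with roots $\lambda_1,\dots,\lambda_m$ (counted with multiplicity), $m_j(P)=\frac1m\sum_{i=1}^m\lambda_i^j$. For positive integers $N,j$, $(N)_j=\prod_{i=1}^j(N-i+1)$ is the falling factorial. *)

theory Defs
  imports "HOL-Analysis.Analysis" "HOL-Computational_Algebra.Polynomial"
    "HOL-Library.Landau_Symbols"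
begin

(* A nonzero complex polynomial has degree p roots counted with multiplicity,
   which is the multiset proots p. *)
definition root_moment :: "nat \<Rightarrow> complex poly \<Rightarrow> complex" where
  "root_moment j p = (\<Sum>x\<in>#proots p. x ^ j) / of_nat (degree p)"

(* The product is taken in the ring 'a, so that the subtraction is not truncated. *)
definition falling_factorial :: "'a::comm_ring_1 \<Rightarrow> nat \<Rightarrow> 'a" where
  "falling_factorial x j = (\<Prod>i=1..j. x - of_nat i + 1)"

end

theory Submission
  imports Defs "HOL-Computational_Algebra.Polynomial_FPS"
    "HOL-Computational_Algebra.Fundamental_Theorem_Algebra"
begin

text \<open>
  The \<open>n\<close>-th derivative of \<open>P (n + d)\<close> only sees the top \<open>d + 1\<close> coefficients of the polynomial.
  Write \<open>m = n + d\<close> and let \<open>c k\<close> be the coefficient of \<open>z ^ (m - k)\<close> in the monic polynomial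
  \<open>P m\<close>; up to sign it is the \<open>k\<close>-th elementary symmetric function of the roots. The normalised
  derivative is the sum over \<open>j \<le> d\<close> of
  \<open>(d choose j) * z ^ j * (c (d - j) / (m choose (d - j)))\<close> (\<open>normalised_deriv_expansion\<close>), and the
  binomial theorem writes \<open>(z - a) ^ d\<close> in the same form with \<open>(- a) ^ (d - j)\<close> as last factor. The
  number of terms is fixed, so everything reduces to a limit of numbers:
  \<open>c k / (m choose k)\<close> tends to \<open>(- a) ^ k\<close> for each fixed \<open>k\<close>, or equivalently,
  \<open>c k / m ^ k\<close> tends to \<open>(- a) ^ k / k!\<close> (\<open>top_coeff_limit\<close>).

  Newton's identities give \<open>c (k + 1)\<close> in terms of \<open>c 0, \<dots>, c k\<close> and the power sums
  \<open>s i\<close> of the roots; after division by \<open>m ^ (k + 1)\<close> the recursion involves the quantities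
  \<open>s i / m ^ i\<close>. For \<open>i = 1\<close> this is the first moment, which tends to \<open>a\<close>. For \<open>i \<ge> 2\<close> it
  vanishes in the limit: because the roots are real, \<open>s 2\<close> is a sum of squared absolute values,
  hence it dominates all higher power sums in the sense \<open>\<bar>s i\<bar> \<le> sqrt (s 2) ^ i\<close>
  (\<open>real_power_sum_bound\<close>), while the hypothesis on the second moment says \<open>s 2 = o(m\<^sup>2)\<close>. In the
  limit only the recursion \<open>(k + 1) * C (k + 1) = - a * C k\<close> with \<open>C 0 = 1\<close> is left, whose solution
  is \<open>C k = (- a) ^ k / k!\<close>.
\<close>

section \<open>Newton's identities\<close>

text \<open>
  Logarithmic differentiation: each factor \<open>1 - x X\<close> contributes \<open>- x / (1 - x X)\<close>, the geometric
  series with coefficients \<open>- x ^ (k + 1)\<close>.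
\<close>

lemma newton_identities_fps:
  fixes A :: "'a::field multiset"
  defines "F \<equiv> (\<Prod>x\<in>#A. 1 - fps_const x * fps_X)"
  shows "fps_deriv F = - (Abs_fps (\<lambda>k. \<Sum>x\<in>#A. x ^ Suc k) * F)"
  unfolding F_def
proof (induction A)
  case empty
  have "Abs_fps (\<lambda>k. \<Sum>x\<in>#{#}. x ^ Suc k) = (0 :: 'a fps)"
    by (simp add: fps_eq_iff)
  then show ?case by simp
next
  case (add x A)
  let ?F = "\<Prod>x\<in>#A. 1 - fps_const x * fps_X"
  let ?S = "\<lambda>B. Abs_fps (\<lambda>k. \<Sum>x\<in>#B. x ^ Suc k)"
  let ?G = "Abs_fps (\<lambda>k. x ^ Suc k)"
  have split: "?S (add_mset x A) = ?G + ?S A"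
    by (simp add: fps_eq_iff)
  have geo: "(1 - fps_const x * fps_X) * ?G = fps_const x"
  proof (rule fps_ext)
    fix n
    show "fps_nth ((1 - fps_const x * fps_X) * ?G) n = fps_nth (fps_const x) n"
      by (cases n) (simp_all add: left_diff_distrib mult.assoc)
  qed
  have "fps_deriv ((1 - fps_const x * fps_X) * ?F)
      = - fps_const x * ?F - (1 - fps_const x * fps_X) * (?S A * ?F)"
    by (simp add: add.IH)
  also have "\<dots> = - ((?G + ?S A) * ((1 - fps_const x * fps_X) * ?F))"
  proof -
    have "(?G + ?S A) * ((1 - fps_const x * fps_X) * ?F)
        = ((1 - fps_const x * fps_X) * ?G) * ?F + (1 - fps_const x * fps_X) * (?S A * ?F)"
      by (subst distrib_right) (simp only: mult_ac)
    then show ?thesis by (simp only: geo) (simp flip: fps_const_neg)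
  qed
  finally show ?case
    unfolding split by (simp only: image_mset_add_mset prod_mset.add_mset)
qed

text \<open>
  Reversing the coefficients turns the linear factor \<open>X - x\<close> into \<open>1 - x X\<close>, also for \<open>x = 0\<close>. The
  reversal numbers the coefficients from the top, as the argument needs: the constant term of the
  series is the leading coefficient.
\<close>

lemma fps_of_reflect_poly_eq_prod:
  fixes p :: "complex poly"
  assumes "lead_coeff p = 1"
  shows "fps_of_poly (reflect_poly p) = (\<Prod>x\<in>#proots p. 1 - fps_const x * fps_X)"
proof -
  have "fps_of_poly (reflect_poly (\<Prod>x\<in>#A. [:-x, 1:]))
      = (\<Prod>x\<in>#A. 1 - fps_const x * fps_X)" for A :: "complex multiset"
  proof (induction A)
    case (add x A)
    have "reflect_poly [:-x, 1:] = [:1, -x:]"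
      by (cases "x = 0") (simp_all add: reflect_poly_def)
    then have "fps_of_poly (reflect_poly [:-x, 1:]) = 1 - fps_const x * fps_X"
      by (simp add: fps_of_poly_pCons fps_const_neg[symmetric] del: fps_const_neg)
    with add.IH show ?case
      by (simp only: image_mset_add_mset prod_mset.add_mset reflect_poly_mult fps_of_poly_mult)
  qed simp
  moreover have "p = (\<Prod>x\<in>#proots p. [:-x, 1:])"
    using complex_poly_decompose_multiset[of p] assms by simp
  ultimately show ?thesis by metis
qed

lemma newton_identity_reflect_poly:
  fixes p :: "complex poly"
  assumes "lead_coeff p = 1"
  shows "of_nat (Suc k) * coeff (reflect_poly p) (Suc k)
    = - (\<Sum>i\<le>k. (\<Sum>x\<in>#proots p. x ^ Suc i) * coeff (reflect_poly p) (k - i))"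
proof -
  have "fps_nth (fps_deriv (fps_of_poly (reflect_poly p))) k
      = fps_nth (- (Abs_fps (\<lambda>k. \<Sum>x\<in>#proots p. x ^ Suc k) * fps_of_poly (reflect_poly p))) k"
    by (simp only: fps_of_reflect_poly_eq_prod[OF assms] newton_identities_fps)
  then show ?thesis
    by (simp add: fps_mult_nth atLeast0AtMost del: of_nat_Suc)
qed

section \<open>Limits of the top coefficients\<close>

text \<open>
  For real \<open>x\<close> the summand \<open>x\<^sup>2\<close> is \<open>\<bar>x\<bar>\<^sup>2\<close>, so \<open>S\<close>, the absolute value of the sum of squares,
  satisfies \<open>\<bar>x\<bar> \<le> sqrt S\<close> for every \<open>x\<close> in \<open>A\<close>. Two of the \<open>i\<close> factors of \<open>\<bar>x\<bar> ^ i\<close> are kept and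
  sum up to \<open>S\<close>; the others are bounded by \<open>sqrt S\<close>. For non-real roots cancellation in the sum of
  squares would destroy this.
\<close>

lemma real_power_sum_bound:
  fixes A :: "complex multiset"
  assumes real: "\<And>x. x \<in># A \<Longrightarrow> x \<in> \<real>" and "i \<ge> 2"
  shows "norm (\<Sum>x\<in>#A. x ^ i) \<le> sqrt (norm (\<Sum>x\<in>#A. x\<^sup>2)) ^ i"
proof -
  define S where "S = (\<Sum>x\<in>#A. (norm x)\<^sup>2)"
  have S_nonneg: "S \<ge> 0"
    unfolding S_def by (induction A) auto
  have "(\<Sum>x\<in>#A. x\<^sup>2) = of_real S"
    unfolding S_def using real
  proof (induction A)
    case (add x A)
    from add.prems[of x] have "x\<^sup>2 = of_real ((norm x)\<^sup>2)"
      by (auto elim!: Reals_cases simp flip: of_real_power)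
    with add show ?case by simp
  qed simp
  then have sq: "norm (\<Sum>x\<in>#A. x\<^sup>2) = S"
    using S_nonneg by simp
  have le: "norm x \<le> sqrt S" if xA: "x \<in># A" for x
  proof -
    obtain B where "A = add_mset x B" using multi_member_split[OF xA] by blast
    moreover have "(\<Sum>x\<in>#B. (norm x)\<^sup>2) \<ge> 0" by (induction B) auto
    ultimately have "(norm x)\<^sup>2 \<le> S" by (simp add: S_def)
    then show ?thesis by (simp add: real_le_rsqrt)
  qed
  have power_i: "y ^ i = y\<^sup>2 * y ^ (i - 2)" for y :: real
    using \<open>i \<ge> 2\<close> by (metis le_add_diff_inverse power_add)
  have "norm (\<Sum>x\<in>#A. x ^ i) \<le> (\<Sum>x\<in>#A. norm x ^ i)"
    by (induction A) (auto simp: norm_power intro: order_trans[OF norm_triangle_ineq])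
  also have "\<dots> \<le> (\<Sum>x\<in>#A. (norm x)\<^sup>2 * sqrt S ^ (i - 2))"
  proof (rule sum_mset_mono)
    fix x assume "x \<in># A"
    have "norm x ^ i = (norm x)\<^sup>2 * norm x ^ (i - 2)"
      by (rule power_i)
    also have "\<dots> \<le> (norm x)\<^sup>2 * sqrt S ^ (i - 2)"
      using le[OF \<open>x \<in># A\<close>] by (intro mult_left_mono power_mono) auto
    finally show "norm x ^ i \<le> (norm x)\<^sup>2 * sqrt S ^ (i - 2)" .
  qed
  also have "\<dots> = S * sqrt S ^ (i - 2)"
    by (simp add: S_def sum_mset_distrib_right)
  also have "\<dots> = (sqrt S)\<^sup>2 * sqrt S ^ (i - 2)"
    using S_nonneg by simp
  also have "\<dots> = sqrt S ^ i"
    by (rule power_i[symmetric])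
  finally show ?thesis by (simp only: sq)
qed

lemma binomial_over_power_limit:
  "(\<lambda>m. of_nat (m choose k) / of_nat m ^ k :: complex) \<longlonglongrightarrow> 1 / fact k"
proof (induction k)
  case (Suc k)
  have "(\<lambda>m. of_nat (m choose k) / of_nat m ^ k * ((1 - of_nat k / of_nat m) / of_nat (Suc k)) :: complex)
      \<longlonglongrightarrow> 1 / fact k * ((1 - 0) / of_nat (Suc k))"
    by (intro tendsto_intros Suc.IH lim_const_over_n) (simp del: of_nat_Suc)
  moreover have "\<forall>\<^sub>F m in sequentially.
     of_nat (m choose k) / of_nat m ^ k * ((1 - of_nat k / of_nat m) / of_nat (Suc k))
     = (of_nat (m choose Suc k) / of_nat m ^ Suc k :: complex)"
    using eventually_gt_at_top[of "k"]
  proof eventually_elim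
    case (elim m)
    have "Suc k * (m choose Suc k) = (m - k) * (m choose k)"
      by (simp only: binomial_absorb_comp binomial_absorption)
    then have "of_nat (Suc k) * of_nat (m choose Suc k) = (of_nat m - of_nat k) * (of_nat (m choose k) :: complex)"
      using elim by (metis less_imp_le of_nat_diff of_nat_mult)
    then have "of_nat (m choose Suc k)
        = (of_nat m - of_nat k) * of_nat (m choose k) / (of_nat (Suc k) :: complex)"
      by (simp add: nonzero_eq_divide_eq mult.commute del: of_nat_Suc)
    moreover have "1 - of_nat k / of_nat m = (of_nat m - of_nat k) / (of_nat m :: complex)"
      using elim by (simp add: diff_divide_distrib)
    ultimately show ?case
      by (simp only:) (simp add: mult_ac del: of_nat_Suc)
  qed
  ultimately show ?case
    by (auto simp: mult.commute dest: Lim_transform_eventually)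
qed simp


text \<open>
  Strong induction on \<open>k\<close> along Newton's identities: divided by \<open>m ^ (k + 1)\<close>, the term with
  index \<open>i\<close> of the recursion splits into a rescaled power sum and a rescaled lower coefficient,
  and in the limit only the first power sum survives.
\<close>

lemma top_coeff_limit:
  fixes P :: "nat \<Rightarrow> complex poly" and a :: complex
  assumes monic: "\<And>m. m \<ge> 1 \<Longrightarrow> lead_coeff (P m) = 1"
    and deg: "\<And>m. m \<ge> 1 \<Longrightarrow> degree (P m) = m"
    and real_roots: "\<And>m z. m \<ge> 1 \<Longrightarrow> poly (P m) z = 0 \<Longrightarrow> z \<in> \<real>"
    and moment1: "(\<lambda>m. root_moment 1 (P m)) \<longlonglongrightarrow> a"
    and moment2: "(\<lambda>m. root_moment 2 (P m)) \<in> o(\<lambda>m. of_nat m)"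
  shows "(\<lambda>m. coeff (reflect_poly (P m)) k / of_nat m ^ k) \<longlonglongrightarrow> (- a) ^ k / fact k"
proof -
  define q where "q m k = coeff (reflect_poly (P m)) k / of_nat m ^ k" for m k
  define s where "s m i = (\<Sum>x\<in>#proots (P m). x ^ i)" for m i
  have pos: "\<forall>\<^sub>F m :: nat in sequentially. m \<ge> 1"
    by (rule eventually_ge_at_top)
  have roots_real: "x \<in> \<real>" if "m \<ge> 1" "x \<in># proots (P m)" for m x
  proof -
    have "P m \<noteq> 0" using monic[OF that(1)] by auto
    then show ?thesis using that real_roots by simp
  qed
  have s1: "(\<lambda>m. s m 1 / of_nat m ^ 1) \<longlonglongrightarrow> a"
  proof (rule Lim_transform_eventually[OF moment1])
    show "\<forall>\<^sub>F m in sequentially. root_moment 1 (P m) = s m 1 / of_nat m ^ 1"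
      using pos by eventually_elim (simp add: root_moment_def s_def deg)
  qed
  have s2: "(\<lambda>m. s m 2 / of_nat m ^ 2) \<longlonglongrightarrow> 0"
  proof (rule Lim_transform_eventually[OF smalloD_tendsto[OF moment2]])
    show "\<forall>\<^sub>F m in sequentially. root_moment 2 (P m) / of_nat m = s m 2 / of_nat m ^ 2"
      using pos by eventually_elim (simp add: root_moment_def s_def deg power2_eq_square)
  qed
  have s_higher: "(\<lambda>m. s m i / of_nat m ^ i) \<longlonglongrightarrow> 0" if "i \<ge> 2" for i
  proof (rule Lim_null_comparison)
    have "(\<lambda>m. sqrt (norm (s m 2 / of_nat m ^ 2)) ^ i) \<longlonglongrightarrow> sqrt (norm (0 :: complex)) ^ i"
      by (intro tendsto_intros s2)
    then show "(\<lambda>m. sqrt (norm (s m 2 / of_nat m ^ 2)) ^ i) \<longlonglongrightarrow> 0"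
      using that by (simp add: power_0_left)
    show "\<forall>\<^sub>F m in sequentially.
        norm (s m i / of_nat m ^ i) \<le> sqrt (norm (s m 2 / of_nat m ^ 2)) ^ i"
      using pos
    proof eventually_elim
      case (elim m)
      have "norm (s m i) \<le> sqrt (norm (s m 2)) ^ i"
        unfolding s_def using roots_real[OF elim] that by (rule real_power_sum_bound)
      then show ?case
        by (simp add: norm_divide norm_power real_sqrt_divide power_divide divide_right_mono)
    qed
  qed
  have newton: "q m (Suc k)
      = - (\<Sum>i\<le>k. s m (Suc i) / of_nat m ^ Suc i * q m (k - i)) / of_nat (Suc k)"
    if "m \<ge> 1" for m k
  proof -
    have "of_nat (Suc k) * q m (Suc k)
        = - (\<Sum>i\<le>k. s m (Suc i) * coeff (reflect_poly (P m)) (k - i)) / of_nat m ^ Suc k"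
      using newton_identity_reflect_poly[OF monic[OF that], of k]
      by (simp add: q_def s_def del: of_nat_Suc)
    also have "(\<Sum>i\<le>k. s m (Suc i) * coeff (reflect_poly (P m)) (k - i))
        = (\<Sum>i\<le>k. s m (Suc i) / of_nat m ^ Suc i * q m (k - i)) * of_nat m ^ Suc k"
      unfolding sum_distrib_right
    proof (rule sum.cong[OF refl])
      fix i assume "i \<in> {..k}"
      then have "Suc k = Suc i + (k - i)" by simp
      then have "of_nat m ^ Suc k = of_nat m ^ Suc i * (of_nat m ^ (k - i) :: complex)"
        by (metis power_add)
      then show "s m (Suc i) * coeff (reflect_poly (P m)) (k - i)
          = s m (Suc i) / of_nat m ^ Suc i * q m (k - i) * of_nat m ^ Suc k"
        using that by (simp only: q_def) simp
    qed
    also have "- ((\<Sum>i\<le>k. s m (Suc i) / of_nat m ^ Suc i * q m (k - i)) * of_nat m ^ Suc k)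
          / of_nat m ^ Suc k
        = - (\<Sum>i\<le>k. s m (Suc i) / of_nat m ^ Suc i * q m (k - i))"
      using that by (simp del: power_Suc)
    finally show ?thesis
      by (simp only: nonzero_eq_divide_eq of_nat_eq_0_iff nat.distinct not_False_eq_True mult.commute)
  qed
  have "(\<lambda>m. q m k) \<longlonglongrightarrow> (- a) ^ k / fact k"
  proof (induction k rule: less_induct)
    case (less k)
    show ?case
    proof (cases k)
      case 0
      have "\<forall>\<^sub>F m in sequentially. 1 = q m 0"
        using pos by eventually_elim (simp add: q_def monic)
      then show ?thesis
        using 0 by (auto intro: Lim_transform_eventually[OF tendsto_const])
    next
      case (Suc j)
      have "(\<lambda>m. - (\<Sum>i\<le>j. s m (Suc i) / of_nat m ^ Suc i * q m (j - i)) / of_nat (Suc j))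
          \<longlonglongrightarrow> - (\<Sum>i\<le>j. (if i = 0 then a else 0) * ((- a) ^ (j - i) / fact (j - i))) / of_nat (Suc j)"
      proof (intro tendsto_divide tendsto_minus tendsto_sum tendsto_mult tendsto_const)
        fix i assume "i \<in> {..j}"
        then show "(\<lambda>m. q m (j - i)) \<longlonglongrightarrow> (- a) ^ (j - i) / fact (j - i)"
          using Suc by (intro less.IH) auto
        show "(\<lambda>m. s m (Suc i) / of_nat m ^ Suc i) \<longlonglongrightarrow> (if i = 0 then a else 0)"
          using s1 s_higher[of "Suc i"] by (cases "i = 0") (simp_all only: if_True if_False One_nat_def, auto)
      qed (simp del: of_nat_Suc)
      also have "(\<Sum>i\<le>j. (if i = 0 then a else 0) * ((- a) ^ (j - i) / fact (j - i)))
          = a * ((- a) ^ j / fact j)"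
      proof -
        have "(\<Sum>i\<le>j. (if i = 0 then a else 0) * ((- a) ^ (j - i) / fact (j - i)))
            = (\<Sum>i\<le>j. if i = 0 then a * ((- a) ^ j / fact j) else 0)"
          by (intro sum.cong) auto
        then show ?thesis by simp
      qed
      also have "- (a * ((- a) ^ j / fact j)) / of_nat (Suc j) = (- a) ^ k / fact k"
        by (simp add: Suc)
      finally show ?thesis
        by (rule Lim_transform_eventually)
          (use pos in \<open>eventually_elim, simp only: Suc newton\<close>)
    qed
  qed
  then show ?thesis by (simp only: q_def)
qed

lemma limit_over_binomial:
  fixes q :: "nat \<Rightarrow> complex"
  assumes "(\<lambda>m. q m / of_nat m ^ k) \<longlonglongrightarrow> c / fact k"
  shows "(\<lambda>m. q m / of_nat (m choose k)) \<longlonglongrightarrow> c"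
proof -
  have "(\<lambda>m. (q m / of_nat m ^ k) / (of_nat (m choose k) / of_nat m ^ k)) \<longlonglongrightarrow> (c / fact k) / (1 / fact k)"
    by (intro tendsto_divide assms binomial_over_power_limit) simp
  moreover have "\<forall>\<^sub>F m in sequentially.
      (q m / of_nat m ^ k) / (of_nat (m choose k) / of_nat m ^ k) = q m / of_nat (m choose k)"
    using eventually_gt_at_top[of 0] by eventually_elim simp
  ultimately show ?thesis by (simp add: Lim_transform_eventually)
qed

section \<open>Expansion of the normalised derivative\<close>

lemma falling_factorial_Suc:
  "falling_factorial (x :: 'a::comm_ring_1) (Suc n) = x * falling_factorial (x - 1) n"
proof -
  have shift: "falling_factorial y k = (\<Prod>i<k. y - of_nat i)" for y :: 'a and k
    by (simp add: falling_factorial_def prod.atLeast1_atMost_eq algebra_simps)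
  show ?thesis
    unfolding shift prod.lessThan_Suc_shift by (simp add: algebra_simps)
qed

lemma falling_factorial_of_nat:
  "falling_factorial (of_nat (n + d)) n = (fact (n + d) / fact d :: 'a::field_char_0)"
proof (induction n)
  case 0
  show ?case by (simp add: falling_factorial_def)
next
  case (Suc n)
  have "of_nat (Suc n + d) - (1 :: 'a) = of_nat (n + d)" by simp
  then show ?case
    by (simp only: falling_factorial_Suc Suc.IH) (simp add: algebra_simps)
qed

lemma higher_deriv_poly:
  "(deriv ^^ n) (poly p) = poly ((pderiv ^^ n) (p :: 'a::real_normed_field poly))"
  by (induction n) (auto intro!: DERIV_imp_deriv poly_DERIV)

text \<open>
  Differentiating multiplies the coefficient of \<open>z ^ (n + j)\<close> by \<open>(n + j)! / j!\<close>, and the normalising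
  factor is \<open>d! / (n + d)!\<close>. The product of the two is the quotient of \<open>d choose j\<close> by
  \<open>(n + d) choose (d - j)\<close>, both of which contain the same factor \<open>1 / (d - j)!\<close>.
\<close>

lemma normalised_deriv_expansion:
  fixes p :: "complex poly"
  assumes "degree p = n + d"
  shows "1 / falling_factorial (of_nat (n + d)) n * (deriv ^^ n) (poly p) z
    = (\<Sum>j\<le>d. of_nat (d choose j) * z ^ j
        * (coeff (reflect_poly p) (d - j) / of_nat ((n + d) choose (d - j))))"
proof -
  have poch: "pochhammer (of_nat (Suc j)) n = (fact (n + j) / fact j :: complex)" for j
    using pochhammer_product'[of "1 :: complex" j n]
    by (simp add: add.commute field_simps flip: pochhammer_fact)
  have "(deriv ^^ n) (poly p) z = (\<Sum>j\<le>d. coeff ((pderiv ^^ n) p) j * z ^ j)"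
    using assms by (simp add: higher_deriv_poly poly_altdef degree_higher_pderiv)
  then have "1 / falling_factorial (of_nat (n + d)) n * (deriv ^^ n) (poly p) z
    = (\<Sum>j\<le>d. (fact d / fact (n + d)) * (fact (n + j) / fact j * coeff p (n + j) * z ^ j))"
    by (simp only: falling_factorial_of_nat coeff_higher_pderiv poch sum_distrib_left)
       (simp add: add.commute)
  also have "\<dots> = (\<Sum>j\<le>d. of_nat (d choose j) * z ^ j
        * (coeff (reflect_poly p) (d - j) / of_nat ((n + d) choose (d - j))))"
  proof (rule sum.cong[OF refl])
    fix j assume "j \<in> {..d}"
    then have j: "j \<le> d" "n + d - (d - j) = n + j" by auto
    have "of_nat (d choose j) = (fact d / (fact j * fact (d - j)) :: complex)"
      using j by (simp add: binomial_fact)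
    moreover have "of_nat ((n + d) choose (d - j)) = (fact (n + d) / (fact (d - j) * fact (n + j)) :: complex)"
      using binomial_fact[of "d - j" "n + d", where 'a = complex] j by simp
    moreover have "coeff (reflect_poly p) (d - j) = coeff p (n + j)"
      using j assms by (simp add: coeff_reflect_poly)
    ultimately show "(fact d / fact (n + d)) * (fact (n + j) / fact j * coeff p (n + j) * z ^ j)
      = of_nat (d choose j) * z ^ j
        * (coeff (reflect_poly p) (d - j) / of_nat ((n + d) choose (d - j)))"
      by (simp add: mult_ac)
  qed
  finally show ?thesis .
qed

section \<open>Uniform convergence on compact sets\<close>

lemma uniform_limit_polynomial:
  fixes c :: "nat \<Rightarrow> nat \<Rightarrow> complex"
  assumes "compact K" and "\<And>j. j \<le> d \<Longrightarrow> (\<lambda>n. c n j) \<longlonglongrightarrow> l j"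
  shows "uniform_limit K (\<lambda>n z. \<Sum>j\<le>d. b j * z ^ j * c n j) (\<lambda>z. \<Sum>j\<le>d. b j * z ^ j * l j) sequentially"
proof -
  have "uniform_limit K (\<lambda>n z. b j * z ^ j * c n j) (\<lambda>z. b j * z ^ j * l j) sequentially"
    if "j \<le> d" for j
  proof (rule uniform_lim_mult)
    show "uniform_limit K (\<lambda>n z. b j * z ^ j) (\<lambda>z. b j * z ^ j) sequentially"
      by (rule uniform_limit_const)
    show "uniform_limit K (\<lambda>n z. c n j) (\<lambda>z. l j) sequentially"
      using assms(2)[OF that] by (simp add: uniform_limit_iff tendsto_iff eventually_mono)
    show "bounded ((\<lambda>z. b j * z ^ j) ` K)"
      by (intro compact_imp_bounded compact_continuous_image continuous_intros assms(1))
    show "bounded ((\<lambda>z. l j) ` K)"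
      by (rule bounded_subset[of "{l j}"]) auto
  qed
  then show ?thesis
    by (induction d) (simp_all add: uniform_limit_add del: power_Suc)
qed

theorem theorem2p9:
  fixes P :: "nat \<Rightarrow> complex poly" and a :: real and d :: nat
  assumes monic: "\<And>m. m \<ge> 1 \<Longrightarrow> lead_coeff (P m) = 1"
    and deg: "\<And>m. m \<ge> 1 \<Longrightarrow> degree (P m) = m"
    and real_roots: "\<And>m z. m \<ge> 1 \<Longrightarrow> poly (P m) z = 0 \<Longrightarrow> z \<in> \<real>"
    and moment1: "(\<lambda>m. root_moment 1 (P m)) \<longlonglongrightarrow> complex_of_real a"
    and moment2: "(\<lambda>m. root_moment 2 (P m)) \<in> o(\<lambda>m. of_nat m)"
  shows "\<forall>K. compact K \<longrightarrow>
    uniform_limit K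
      (\<lambda>n z. 1 / falling_factorial (of_nat (n + d)) n * (deriv ^^ n) (poly (P (d + n))) z)
      (\<lambda>z. (z - complex_of_real a) ^ d) sequentially"
proof (intro allI impI)
  fix K :: "complex set" assume K: "compact K"
  define c where
    "c n j = coeff (reflect_poly (P (n + d))) (d - j) / of_nat ((n + d) choose (d - j))" for n j
  have c_limit: "(\<lambda>n. c n j) \<longlonglongrightarrow> (- complex_of_real a) ^ (d - j)" for j
    unfolding c_def
    using limit_over_binomial[OF top_coeff_limit[OF assms, where k = "d - j"]]
    by (rule LIMSEQ_ignore_initial_segment)
  have target: "(z - complex_of_real a) ^ d
      = (\<Sum>j\<le>d. of_nat (d choose j) * z ^ j * (- complex_of_real a) ^ (d - j))" for z
    using binomial_ring[of z "- complex_of_real a" d] by simp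
  have "\<forall>\<^sub>F n in sequentially. \<forall>z\<in>K. (\<Sum>j\<le>d. of_nat (d choose j) * z ^ j * c n j)
      = 1 / falling_factorial (of_nat (n + d)) n * (deriv ^^ n) (poly (P (d + n))) z"
    using eventually_ge_at_top[of 1]
  proof eventually_elim
    case (elim n)
    then have "degree (P (n + d)) = n + d" by (intro deg) simp
    from normalised_deriv_expansion[OF this] show ?case
      by (simp only: c_def add.commute[of d n]) simp
  qed
  then show "uniform_limit K
      (\<lambda>n z. 1 / falling_factorial (of_nat (n + d)) n * (deriv ^^ n) (poly (P (d + n))) z)
      (\<lambda>z. (z - complex_of_real a) ^ d) sequentially"
    using uniform_limit_polynomial[OF K c_limit, where d = d and b = "\<lambda>j. of_nat (d choose j)"]
    by (subst uniform_limit_cong[symmetric]) (auto simp: target)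
qed

end
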